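(* Let $\mathcal{P}=\{\bm x\in\mathbb{R}^K:\bm S\bm x\le\bm t\}$, with $\bm S\in\mathbb{R}^{J\times K}$ and $\bm t\in\mathbb{R}^J$, be a polytope that is compact and full-dimensional. Then $\mathrm{Vol}(\mathcal{E}_{\mathrm{zrh}})\ge\mathrm{Vol}(\mathcal{E}_{\mathrm{smvie}})$, where $\mathcal{E}_{\mathrm{zrh}}$ is the ellipsoid given by the decision rule approximation and $\mathcal{E}_{\mathrm{smvie}}$ is the maximum volume ellipsoid inscribed in $\mathcal{P}$ scaled around its center by the factor $K$ (both defined in the context).
   Context: $\mathbb{S}^K$, $\mathbb{S}^K_{++}$ are the real symmetric and symmetric positive definite $K\times K$ matrices; $\|\cdot\|$ is the Euclidean norm; for a matrix $\bm M$, $\bm M_{j:}$ is the transpose of its $j$-th row. Full-dimensional means having nonempty interior. For $\bm A\in\mathbb{S}^K_{++}$, $\bm b\in\mathbb{R}^K$, let $\mathcal{E}(\bm A,\bm b)=\{\bm x\in\mathbb{R}^K:\|\bm A\bm x+\bm b\|^2\le1\}$ and (dropping a dimension-dependent constant) $\mathrm{Vol}(\mathcal{E}(\bm A,\bm b))=1/\det(\bm A)$. The function $-\log\det(\cdot)$ is $+\infty$ at symmetric matrices that are not positive definite. $\mathcal{E}_{\mathrm{zrh}}=\mathcal{E}(\bm A,\bm b)$, where $(\bm A,\bm b,\bm V,\bm v)$ is an optimal solution of: minimize $-\log\det(\bm A)$ over $\bm A\in\mathbb{S}^K$, $\bm b\in\mathbb{R}^K$, $\bm V\in\mathbb{R}^{J\times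 K}$, $\bm v\in\mathbb{R}^J$ subject to $$\|\bm V^\top\bm t+\bm b\|+\bm t^\top\bm v\le1,\quad\bm A=\bm V^\top\bm S,\quad\bm S^\top\bm v=\bm 0,\quad\|\bm V_{j:}\|\le v_j\ \ (j=1,\dots,J).$$ $\mathcal{E}_{\mathrm{smvie}}=\{K\bm B\bm u+\bm d:\bm u\in\mathbb{R}^K,\|\bm u\|\le1\}$, where $(\bm B,\bm d)$ is an optimal solution of: maximize $\log\det(\bm B)$ over $\bm B\in\mathbb{S}^K$ (implicitly positive definite), $\bm d\in\mathbb{R}^K$ subject to $\|\bm B\bm S_{j:}\|+\bm S_{j:}^\top\bm d\le t_j$ for all $j=1,\dots,J$. With the volume convention $\mathrm{Vol}(\mathcal{E}(\bm A,\bm b))=1/\det(\bm A)$, one has $\mathrm{Vol}(\mathcal{E}_{\mathrm{smvie}})=\det(K\bm B)$. *)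

theory Defs
  imports "HOL-Analysis.Analysis"
begin

definition sym_mat :: "real^'k^'k \<Rightarrow> bool" where
  "sym_mat M \<longleftrightarrow> transpose M = M"

definition pos_def :: "real^'k^'k \<Rightarrow> bool" where
  "pos_def M \<longleftrightarrow> sym_mat M \<and> (\<forall>x. x \<noteq> 0 \<longrightarrow> 0 < x \<bullet> (M *v x))"

definition log_det :: "real^'k^'k \<Rightarrow> ereal" where
  "log_det M = (if pos_def M then ereal (ln (det M)) else -\<infinity>)"

text \<open>The order on vectors is the componentwise one.\<close>

definition polyhedron_of :: "real^'k^'j \<Rightarrow> real^'j \<Rightarrow> (real^'k) set" where
  "polyhedron_of S t = {x. S *v x \<le> t}"

definition ellipsoid :: "real^'k^'k \<Rightarrow> real^'k \<Rightarrow> (real^'k) set" where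
  "ellipsoid A b = {x. (norm (A *v x + b))\<^sup>2 \<le> 1}"

text \<open>Lebesgue volume in units of the volume of the Euclidean unit ball. This is the
  dimension-dependent normalisation under which \<^term>\<open>ellipsoid A b\<close> has volume
  \<^term>\<open>1 / det A\<close> for positive definite \<^term>\<open>A\<close>.\<close>

definition Vol :: "(real^'k) set \<Rightarrow> real" where
  "Vol E = measure lebesgue E / measure lebesgue (cball 0 1 :: (real^'k) set)"

definition zrh_feasible ::
  "real^'k^'j \<Rightarrow> real^'j \<Rightarrow> real^'k^'k \<Rightarrow> real^'k \<Rightarrow> real^'k^'j \<Rightarrow> real^'j \<Rightarrow> bool" where
  "zrh_feasible S t A b V v \<longleftrightarrow>
     sym_mat A \<and>
     norm (transpose V *v t + b) + t \<bullet> v \<le> 1 \<and>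
     A = transpose V ** S \<and>
     transpose S *v v = 0 \<and>
     (\<forall>j. norm (row j V) \<le> v $ j)"

text \<open>Optimality is for the extended-valued objective, so positive definiteness of the
  matrix is not a constraint of either problem; it is enforced by the objective
  whenever a positive definite feasible point exists.\<close>

definition zrh_optimal ::
  "real^'k^'j \<Rightarrow> real^'j \<Rightarrow> real^'k^'k \<Rightarrow> real^'k \<Rightarrow> real^'k^'j \<Rightarrow> real^'j \<Rightarrow> bool" where
  "zrh_optimal S t A b V v \<longleftrightarrow>
     zrh_feasible S t A b V v \<and>
     (\<forall>A' b' V' v'. zrh_feasible S t A' b' V' v' \<longrightarrow> - log_det A \<le> - log_det A')"

definition mvie_feasible ::
  "real^'k^'j \<Rightarrow> real^'j \<Rightarrow> real^'k^'k \<Rightarrow> real^'k \<Rightarrow> bool" where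
  "mvie_feasible S t B d \<longleftrightarrow>
     sym_mat B \<and> (\<forall>j. norm (B *v row j S) + row j S \<bullet> d \<le> t $ j)"

definition mvie_optimal ::
  "real^'k^'j \<Rightarrow> real^'j \<Rightarrow> real^'k^'k \<Rightarrow> real^'k \<Rightarrow> bool" where
  "mvie_optimal S t B d \<longleftrightarrow>
     mvie_feasible S t B d \<and>
     (\<forall>B' d'. mvie_feasible S t B' d' \<longrightarrow> log_det B' \<le> log_det B)"

definition smvie :: "real^'k^'k \<Rightarrow> real^'k \<Rightarrow> (real^'k) set" where
  "smvie B d = {real CARD('k) *\<^sub>R (B *v u) + d | u. norm u \<le> 1}"

end

(* For a feasible point (A, b, V, v) of the decision rule problem and a feasible (B, d) of the
   inscribed ellipsoid problem, writing s_j for the rows of S,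
     trace (A B) = sum_j V_j . B s_j <= sum_j v_j |B s_j| <= sum_j v_j (t_j - s_j . d) = v . t <= 1,
   so if both matrices are positive definite, AM-GM for the eigenvalues of A B gives
   det A * det (K B) <= 1. The hypotheses on the polytope make both problems have positive
   definite feasible points, whence both optimal matrices are positive definite. *)

theory Submission
  imports Defs
begin

section \<open>Matrix algebra and symmetric forms\<close>

lemma det_scaleR:
  fixes M :: "real^'k^'k"
  shows "det (c *\<^sub>R M) = c ^ CARD('k) * det M"
proof -
  have "c *\<^sub>R M = (\<chi> i. c *s M $ i)"
    by (simp add: vec_eq_iff)
  then show ?thesis
    using det_rows_mul[of "\<lambda>_. c" "\<lambda>i. M $ i"] by simp
qed

lemma continuous_on_det: "continuous_on X (det :: real^'k^'k \<Rightarrow> real)"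
  unfolding det_def by (intro continuous_intros)

lemma mat_component_inner: "(A *v x) $ j = row j A \<bullet> (x :: real^'k)"
  by (simp add: matrix_vector_mul_component row_def)

text \<open>Reads \<open>M ** A ** transpose N\<close> as a Gram matrix for the form of
  \<open>A\<close>: orthonormality of rows becomes a matrix equation, and sums of form values become
  traces.\<close>

lemma congruence_component:
  fixes A :: "real^'k^'k" and M N :: "real^'k^'n"
  shows "(M ** A ** transpose N) $ i $ j = M $ i \<bullet> (A *v N $ j)"
proof -
  have "M $ i \<bullet> (A *v N $ j) = (M $ i v* A) \<bullet> N $ j"
    by (rule dot_lmul_matrix[symmetric])
  also have "\<dots> = (M ** A ** transpose N) $ i $ j"
    by (simp add: inner_vec_def matrix_matrix_mult_def transpose_def vector_matrix_mult_def mult.commute)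
  finally show ?thesis by simp
qed

lemma sym_mat_inner_commute:
  assumes "sym_mat A"
  shows "x \<bullet> (A *v y) = y \<bullet> (A *v x)"
proof -
  have "x \<bullet> (A *v y) = (A *v x) \<bullet> y"
    using assms by (metis dot_lmul_matrix sym_mat_def transpose_matrix_vector)
  then show ?thesis by (simp add: inner_commute)
qed

section \<open>Positive definite matrices: normal form and determinant inequality\<close>

lemma pos_def_imp_sym: "pos_def A \<Longrightarrow> sym_mat A"
  by (simp add: pos_def_def)

text \<open>The form attains a positive minimum on the compact unit sphere; homogeneity of degree
  two carries this bound to all vectors.\<close>

lemma pos_def_coercive:
  fixes A :: "real^'k^'k"
  assumes "pos_def A"
  obtains m where "m > 0" "\<And>x. m * (norm x)\<^sup>2 \<le> x \<bullet> (A *v x)"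
proof -
  have "continuous_on (sphere 0 1) (\<lambda>x. x \<bullet> (A *v x))"
    by (intro continuous_intros)
  then obtain z where z: "z \<in> sphere 0 1" "\<And>x. x \<in> sphere 0 1 \<Longrightarrow> z \<bullet> (A *v z) \<le> x \<bullet> (A *v x)"
    using continuous_attains_inf[of "sphere 0 1" "\<lambda>x. x \<bullet> (A *v x)"] by auto
  have "z \<noteq> 0" using z(1) by auto
  show ?thesis
  proof (rule that)
    show "z \<bullet> (A *v z) > 0"
      using assms \<open>z \<noteq> 0\<close> by (simp add: pos_def_def)
    fix x :: "real^'k"
    show "z \<bullet> (A *v z) * (norm x)\<^sup>2 \<le> x \<bullet> (A *v x)"
    proof (cases "x = 0")
      case False
      have "z \<bullet> (A *v z) * (norm x)\<^sup>2 \<le> (sgn x \<bullet> (A *v sgn x)) * (norm x)\<^sup>2"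
        using False by (intro mult_right_mono z(2)) (auto simp: norm_sgn)
      also have "\<dots> = (norm x *\<^sub>R sgn x) \<bullet> (A *v (norm x *\<^sub>R sgn x))"
        by (simp only: matrix_vector_mult_scaleR inner_scaleR_left inner_scaleR_right power2_eq_square)
           (simp add: mult_ac)
      also have "norm x *\<^sub>R sgn x = x"
        using False by (simp add: sgn_div_norm)
      finally show ?thesis .
    qed auto
  qed
qed

text \<open>A maximiser of \<open>\<bar>det\<bar>\<close> on the ellipsoid is orthonormal for the form of \<open>A\<close>: shearing one
  row along another and scaling two rows by reciprocal factors both preserve the determinant,
  so neither can decrease the form.\<close>

lemma pos_def_det_maximizer:
  fixes A :: "real^'k^'k"
  assumes "pos_def A"
  shows "\<exists>M. M ** A ** transpose M = mat 1 \<and>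
    (\<forall>N. (\<Sum>i\<in>UNIV. N $ i \<bullet> (A *v N $ i)) \<le> real CARD('k) \<longrightarrow> \<bar>det N\<bar> \<le> \<bar>det M\<bar>)"
proof -
  let ?K = "real CARD('k)"
  define q :: "real^'k^'k \<Rightarrow> real" where "q N = (\<Sum>i\<in>UNIV. N $ i \<bullet> (A *v N $ i))" for N
  \<comment> \<open>The bound is the trace of the identity, the matrix that
    \<open>M ** A ** transpose M\<close> is meant to become; \<open>q N\<close> is the trace of
    \<open>N ** A ** transpose N\<close>.\<close>
  define X where "X = {N. q N \<le> ?K}"
  obtain m where m: "m > 0" "\<And>x. m * (norm x)\<^sup>2 \<le> x \<bullet> (A *v x)"
    using pos_def_coercive[OF assms] by blast
  have q_lower: "m * (norm N)\<^sup>2 \<le> q N" for N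
  proof -
    have "m * (norm N)\<^sup>2 = (\<Sum>i\<in>UNIV. m * (norm (N $ i))\<^sup>2)"
      by (simp add: norm_vec_def L2_set_def sum_nonneg sum_distrib_left)
    also have "\<dots> \<le> q N"
      unfolding q_def by (intro sum_mono m(2))
    finally show ?thesis .
  qed
  have q_scale: "q (c *\<^sub>R N) = c\<^sup>2 * q N" for c N
    unfolding q_def
    by (simp add: matrix_vector_mult_scaleR sum_distrib_left power2_eq_square mult_ac)
  have "continuous_on UNIV (\<lambda>N :: real^'k^'k. A *v N $ i)" for i
    by (rule continuous_on_compose2[of UNIV "(*v) A"]) (auto intro!: continuous_intros)
  then have "continuous_on UNIV q"
    unfolding q_def by (intro continuous_intros)
  then have "closed X"
    unfolding X_def using closed_Collect_le[of q "\<lambda>_. ?K"] by simp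
  moreover have "bounded X"
    unfolding bounded_iff
  proof (intro exI ballI)
    fix N assume "N \<in> X"
    then have "m * (norm N)\<^sup>2 \<le> ?K" using q_lower[of N] by (simp add: X_def)
    then have "(norm N)\<^sup>2 \<le> ?K / m" using m(1) by (simp add: field_simps)
    then show "norm N \<le> sqrt (?K / m)" by (rule real_le_rsqrt)
  qed
  ultimately have "compact X" by (simp add: compact_eq_bounded_closed)
  moreover have "0 \<in> X" by (simp add: X_def q_def)
  moreover have "continuous_on X (\<lambda>N. \<bar>det N\<bar>)"
    by (intro continuous_intros continuous_on_det)
  ultimately obtain M where M: "M \<in> X" "\<And>N. N \<in> X \<Longrightarrow> \<bar>det N\<bar> \<le> \<bar>det M\<bar>"
    using continuous_attains_sup[of X "\<lambda>N. \<bar>det N\<bar>"] by blast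
  \<comment> \<open>The multiple of the identity lying on the boundary of \<open>X\<close> is a
    competitor with nonzero determinant.\<close>
  have "det M \<noteq> 0"
  proof -
    have "q (mat 1) > 0"
    proof -
      have "mat 1 \<noteq> (0 :: real^'k^'k)"
        by (metis det_I det_0 zero_neq_one mat_0)
      then have "0 < m * (norm (mat 1 :: real^'k^'k))\<^sup>2" using m(1) by simp
      then show ?thesis using q_lower[of "mat 1"] by linarith
    qed
    define c where "c = sqrt (?K / q (mat 1))"
    have "c > 0" "c\<^sup>2 * q (mat 1) = ?K"
      using \<open>q (mat 1) > 0\<close> by (auto simp: c_def)
    then have "c *\<^sub>R mat 1 \<in> X" by (simp add: X_def q_scale)
    from M(2)[OF this] show ?thesis
      using zero_less_power[OF \<open>c > 0\<close>, of "CARD('k)"] by (auto simp: det_scaleR)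
  qed
  \<comment> \<open>With a smaller value of \<open>q\<close>, \<open>N\<close> could be enlarged
    within \<open>X\<close>, beating the determinant of \<open>M\<close>. So \<open>M\<close>
    minimises \<open>q\<close> among matrices with the same absolute determinant.\<close>
  have q_ge: "q N \<ge> ?K" if "\<bar>det N\<bar> = \<bar>det M\<bar>" for N
  proof (rule ccontr)
    assume less: "\<not> q N \<ge> ?K"
    have "N \<noteq> 0" using that \<open>det M \<noteq> 0\<close> by (metis abs_eq_0 det_0 mat_0)
    then have "0 < m * (norm N)\<^sup>2" using m(1) by simp
    then have "q N > 0" using q_lower[of N] by linarith
    define c where "c = sqrt (?K / q N)"
    have "c > 1" "c\<^sup>2 * q N = ?K" using \<open>q N > 0\<close> less by (auto simp: c_def)
    then have "c *\<^sub>R N \<in> X" by (simp add: X_def q_scale)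
    from M(2)[OF this] have "c ^ CARD('k) * \<bar>det M\<bar> \<le> \<bar>det M\<bar>"
      using that \<open>c > 1\<close> by (simp add: det_scaleR abs_mult)
    moreover have "c ^ CARD('k) > 1" using \<open>c > 1\<close> by (simp add: one_less_power)
    ultimately show False using \<open>det M \<noteq> 0\<close> by auto
  qed
  have qM: "q M = ?K" using q_ge[of M] M(1) by (simp add: X_def)
  define \<alpha> where "\<alpha> i j = M $ i \<bullet> (A *v M $ j)" for i j
  have \<alpha>_sym: "\<alpha> i j = \<alpha> j i" for i j
    unfolding \<alpha>_def by (rule sym_mat_inner_commute[OF pos_def_imp_sym[OF assms]])
  have \<alpha>_pos: "\<alpha> i i > 0" for i
  proof -
    have "row i M \<noteq> 0" using \<open>det M \<noteq> 0\<close> det_zero_row by blast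
    then show ?thesis using assms by (simp add: \<alpha>_def pos_def_def row_def vec_nth_inverse)
  qed
  have off_diag: "\<alpha> i k = 0" if "i \<noteq> k" for i k
  proof -
    have *: "0 \<le> 2 * s * \<alpha> i k + s\<^sup>2 * \<alpha> i i" for s
    proof -
      define N where "N = (\<chi> l. if l = k then row k M + s *s row i M else row l M)"
      have "det N = det M" unfolding N_def using that by (intro det_row_operation) auto
      then have "q M \<le> q N" using q_ge[of N] qM by simp
      moreover have "q N - q M = (\<Sum>l\<in>UNIV. if l = k then 2 * s * \<alpha> i k + s\<^sup>2 * \<alpha> i i else 0)"
        unfolding q_def sum_subtractf[symmetric]
      proof (rule sum.cong[OF refl])
        fix l
        have "N $ k = M $ k + s *\<^sub>R M $ i"
          by (simp add: N_def row_def vec_eq_iff)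
        then have "N $ k \<bullet> (A *v N $ k) = \<alpha> k k + s * \<alpha> k i + s * \<alpha> i k + s * s * \<alpha> i i"
          by (simp add: \<alpha>_def matrix_vector_right_distrib matrix_vector_mult_scaleR
              inner_add_left inner_add_right algebra_simps)
        moreover have "l \<noteq> k \<Longrightarrow> N $ l = M $ l" by (simp add: N_def row_def vec_eq_iff)
        ultimately show "N $ l \<bullet> (A *v N $ l) - M $ l \<bullet> (A *v M $ l)
            = (if l = k then 2 * s * \<alpha> i k + s\<^sup>2 * \<alpha> i i else 0)"
          using \<alpha>_sym[of i k] by (auto simp: \<alpha>_def power2_eq_square)
      qed
      ultimately show ?thesis by simp
    qed
    \<comment> \<open>The parabola in \<open>s\<close> is evaluated at its vertex.\<close>
    have "0 \<le> - ((\<alpha> i k)\<^sup>2 / \<alpha> i i)"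
      using *[of "- \<alpha> i k / \<alpha> i i"] \<alpha>_pos[of i] by (simp add: power2_eq_square field_simps)
    then have "(\<alpha> i k)\<^sup>2 \<le> 0" using \<alpha>_pos[of i] by (simp add: field_simps)
    then show ?thesis by simp
  qed
  have diag_eq: "\<alpha> i i = \<alpha> k k" if "i \<noteq> k" for i k
  proof -
    have *: "0 \<le> (x - 1) * \<alpha> i i + (1 / x - 1) * \<alpha> k k" if "x > 0" for x
    proof -
      \<comment> \<open>The form is quadratic, so scaling the rows by \<open>r\<close> and
        \<open>1 / r\<close> scales their form values by \<open>x\<close> and
        \<open>1 / x\<close>.\<close>
      define r where "r = sqrt x"
      have r: "r > 0" "r * r = x" using that by (auto simp: r_def)
      define f where "f l = (if l = i then r else if l = k then 1 / r else 1)" for l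
      define N where "N = (\<chi> l. f l *s M $ l)"
      have "(\<Prod>l\<in>UNIV. f l) = (\<Prod>l\<in>{i,k}. f l)"
        by (rule prod.mono_neutral_right) (auto simp: f_def)
      also have "\<dots> = 1" using \<open>i \<noteq> k\<close> r by (simp add: f_def)
      finally have "det N = det M"
        unfolding N_def det_rows_mul by simp
      then have "q M \<le> q N" using q_ge[of N] qM by simp
      moreover have "q N - q M = (\<Sum>l\<in>UNIV. ((f l)\<^sup>2 - 1) * \<alpha> l l)"
        unfolding q_def sum_subtractf[symmetric]
        by (rule sum.cong) (auto simp: N_def \<alpha>_def scalar_mult_eq_scaleR matrix_vector_mult_scaleR
            power2_eq_square algebra_simps)
      moreover have "(\<Sum>l\<in>UNIV. ((f l)\<^sup>2 - 1) * \<alpha> l l) = (\<Sum>l\<in>{i,k}. ((f l)\<^sup>2 - 1) * \<alpha> l l)"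
        by (rule sum.mono_neutral_right) (auto simp: f_def)
      ultimately show ?thesis
        using \<open>i \<noteq> k\<close> r by (simp add: f_def power2_eq_square)
    qed
    define a b where "a = \<alpha> i i" and "b = \<alpha> k k"
    have ab: "a > 0" "b > 0" by (auto simp: a_def b_def \<alpha>_pos)
    \<comment> \<open>After multiplication by \<open>x\<close>, the change in \<open>q\<close> is
      \<open>(x - 1) * (x * a - b)\<close>, with roots 1 and \<open>b / a\<close>; their midpoint
      minimises it.\<close>
    define x where "x = (a + b) / (2 * a)"
    have "x > 0" using ab by (simp add: x_def)
    have "0 \<le> x * ((x - 1) * a + (1 / x - 1) * b)"
      using *[OF \<open>x > 0\<close>] \<open>x > 0\<close> by (simp add: a_def b_def)
    also have "\<dots> = (x - 1) * (x * a - b)"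
      using \<open>x > 0\<close> by (simp add: field_simps)
    also have "\<dots> = - ((a - b)\<^sup>2 / (4 * a))"
      using ab by (simp add: x_def field_simps power2_eq_square)
    finally have "(a - b)\<^sup>2 \<le> 0" using ab by (simp add: field_simps)
    then show ?thesis by (simp add: a_def b_def)
  qed
  have diag: "\<alpha> i i = 1" for i
  proof -
    have "?K = (\<Sum>l\<in>UNIV. \<alpha> l l)" using qM by (simp add: q_def \<alpha>_def)
    also have "\<dots> = (\<Sum>l\<in>(UNIV :: 'k set). \<alpha> i i)"
      by (rule sum.cong) (use diag_eq in metis)+
    finally show ?thesis by simp
  qed
  show ?thesis
  proof (intro exI[of _ M] conjI allI impI)
    show "M ** A ** transpose M = mat 1"
      using diag off_diag by (auto simp: vec_eq_iff congruence_component mat_def \<alpha>_def)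
    show "\<bar>det N\<bar> \<le> \<bar>det M\<bar>" if "(\<Sum>i\<in>UNIV. N $ i \<bullet> (A *v N $ i)) \<le> ?K" for N
      using that M(2) by (simp add: X_def q_def)
  qed
qed

lemma pos_def_det_pos:
  fixes A :: "real^'k^'k"
  assumes "pos_def A"
  shows "det A > 0"
proof -
  obtain M :: "real^'k^'k" where "M ** A ** transpose M = mat 1"
    using pos_def_det_maximizer[OF assms] by metis
  then have "det M * det A * det M = 1"
    by (metis det_mul det_I det_transpose)
  then have "(det M)\<^sup>2 * det A = 1" by (simp add: power2_eq_square mult_ac)
  then show ?thesis
    by (metis not_less mult_nonneg_nonpos zero_le_power2 zero_less_one)
qed

text \<open>The AM-GM inequality for the eigenvalues of \<open>A ** B\<close>, at the normalisation
  \<open>trace (A ** B) \<le> 1\<close>.\<close>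

lemma pos_def_det_mult_le:
  fixes A B :: "real^'k^'k"
  assumes A: "pos_def A" and B: "pos_def B" and tr: "trace (A ** B) \<le> 1"
  shows "det A * det (real CARD('k) *\<^sub>R B) \<le> 1"
proof -
  let ?K = "real CARD('k)"
  obtain M where M: "M ** A ** transpose M = mat 1"
    and max: "\<And>N. (\<Sum>i\<in>UNIV. N $ i \<bullet> (A *v N $ i)) \<le> ?K \<Longrightarrow> \<bar>det N\<bar> \<le> \<bar>det M\<bar>"
    using pos_def_det_maximizer[OF A] by metis
  obtain P :: "real^'k^'k" where P: "P ** B ** transpose P = mat 1"
    using pos_def_det_maximizer[OF B] by metis
  then have "det P \<noteq> 0"
    by (metis det_mul det_I mult_zero_left zero_neq_one)
  then obtain L where L: "L ** P = mat 1" "P ** L = mat 1"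
    using invertible_det_nz[of P] by (auto simp: invertible_def)
  \<comment> \<open>Undoing the congruence by the inverse \<open>L\<close> of \<open>P\<close>
    yields the factorisation \<open>L ** transpose L\<close> of \<open>B\<close>.\<close>
  have "B = (L ** P) ** B ** (transpose P ** transpose L)"
    by (simp add: L matrix_transpose_mul[symmetric] transpose_mat)
  also have "\<dots> = L ** (P ** B ** transpose P) ** transpose L"
    by (simp add: matrix_mul_assoc)
  also have "\<dots> = L ** transpose L" by (simp add: P)
  finally have BL: "B = L ** transpose L" .
  \<comment> \<open>The competitor for the maximality of \<open>M\<close>: its form sum is
    \<open>?K * trace (A ** B)\<close>, hence at most \<open>?K\<close>, and its squared determinant
    is that of \<open>?K *\<^sub>R B\<close>.\<close>
  define N where "N = sqrt ?K *\<^sub>R transpose L"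
  have "(\<Sum>i\<in>UNIV. N $ i \<bullet> (A *v N $ i)) = ?K * trace (transpose L ** A ** transpose (transpose L))"
    unfolding trace_def congruence_component N_def
    by (simp add: matrix_vector_mult_scaleR sum_distrib_left mult.assoc[symmetric])
  also have "trace (transpose L ** A ** transpose (transpose L)) = trace (A ** B)"
    by (simp add: BL matrix_mul_assoc[symmetric] trace_mul_sym[of "transpose L"])
  finally have "\<bar>det N\<bar> \<le> \<bar>det M\<bar>"
    using max[of N] tr by (simp add: mult_left_le)
  then have "(det N)\<^sup>2 \<le> (det M)\<^sup>2" by (simp add: abs_le_square_iff)
  moreover have "(det N)\<^sup>2 = det (?K *\<^sub>R B)"
    by (simp add: N_def det_scaleR BL det_mul det_transpose power_mult_distrib
        power2_eq_square mult.assoc[symmetric] flip: power_mult_distrib)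
  ultimately have "det A * det (?K *\<^sub>R B) \<le> det A * (det M)\<^sup>2"
    using pos_def_det_pos[OF A] by (intro mult_left_mono) auto
  also have "\<dots> = det (M ** A ** transpose M)"
    by (simp add: det_mul det_transpose power2_eq_square)
  finally show ?thesis by (simp add: M)
qed

section \<open>Weak duality between the two problems\<close>

text \<open>The entries of \<open>v\<close> act as nonnegative multipliers for the inscribed
  ellipsoid constraints: they bound the rows of \<open>V\<close> in the Cauchy-Schwarz estimate, and
  \<open>transpose S *v v = 0\<close> removes the center \<open>d\<close>.\<close>

lemma zrh_mvie_trace_le:
  fixes S :: "real^'k^'j"
  assumes zrh: "zrh_feasible S t A b V v" and mvie: "mvie_feasible S t B d"
  shows "trace (A ** B) \<le> 1"
proof -
  have symB: "transpose B = B" and t: "norm (B *v row j S) + row j S \<bullet> d \<le> t $ j" for j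
    using mvie by (auto simp: mvie_feasible_def sym_mat_def)
  have Sv: "transpose S *v v = 0" and V: "norm (row j V) \<le> v $ j" for j
    using zrh by (auto simp: zrh_feasible_def)
  have "trace (A ** B) = trace ((S ** B) ** transpose V)"
    using zrh unfolding zrh_feasible_def
    by (metis matrix_mul_assoc trace_mul_sym)
  also have "\<dots> = (\<Sum>j\<in>UNIV. (B *v row j S) \<bullet> row j V)"
    unfolding trace_def
  proof (rule sum.cong[OF refl])
    fix j
    have "(S ** B ** transpose V) $ j $ j = (S $ j) \<bullet> (B *v V $ j)"
      by (rule congruence_component)
    also have "\<dots> = V $ j \<bullet> (B *v S $ j)"
      using symB by (intro sym_mat_inner_commute) (simp add: sym_mat_def)
    finally show "(S ** B ** transpose V) $ j $ j = (B *v row j S) \<bullet> row j V"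
      by (simp add: row_def inner_commute vec_nth_inverse)
  qed
  also have "\<dots> \<le> (\<Sum>j\<in>UNIV. (t $ j - row j S \<bullet> d) * v $ j)"
  proof (rule sum_mono)
    fix j
    have "(B *v row j S) \<bullet> row j V \<le> norm (B *v row j S) * norm (row j V)"
      by (rule norm_cauchy_schwarz)
    also have "\<dots> \<le> (t $ j - row j S \<bullet> d) * v $ j"
    proof (rule mult_mono)
      show "norm (B *v row j S) \<le> t $ j - row j S \<bullet> d" using t[of j] by simp
      then show "0 \<le> t $ j - row j S \<bullet> d" using norm_ge_zero order_trans by blast
    qed (use V in auto)
    finally show "(B *v row j S) \<bullet> row j V \<le> (t $ j - row j S \<bullet> d) * v $ j" .
  qed
  also have "\<dots> = t \<bullet> v - (S *v d) \<bullet> v"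
    by (simp add: inner_vec_def[of t] inner_vec_def[of "S *v d"] mat_component_inner
        left_diff_distrib sum_subtractf)
  also have "(S *v d) \<bullet> v = d \<bullet> (transpose S *v v)"
    by (metis dot_lmul_matrix inner_commute transpose_matrix_vector)
  also have "t \<bullet> v - d \<bullet> (transpose S *v v) \<le> 1"
    using zrh Sv unfolding zrh_feasible_def by (smt (verit) inner_zero_right norm_ge_zero)
  finally show ?thesis .
qed

section \<open>Positive definite feasible points\<close>

text \<open>A nonzero \<open>y\<close> would be a recession direction: the ray from \<open>d\<close>
  along \<open>y\<close> would stay in the polyhedron and leave every ball.\<close>

lemma recession_trivial:
  fixes S :: "real^'k^'j"
  assumes "bounded (polyhedron_of S t)" "d \<in> polyhedron_of S t" "S *v y \<le> 0"
  shows "y = 0"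
proof (rule ccontr)
  assume "y \<noteq> 0"
  obtain r where r: "\<And>x. x \<in> polyhedron_of S t \<Longrightarrow> norm x \<le> r"
    using assms(1) by (auto simp: bounded_iff)
  \<comment> \<open>Makes the length of \<open>c *\<^sub>R y\<close> exceed
    \<open>r + norm d\<close> by one, so that the point reached has norm above
    \<open>r\<close>.\<close>
  define c where "c = (r + norm d + 1) / norm y"
  have "r \<ge> norm d" using r assms(2) by blast
  then have "r \<ge> 0" by (smt (verit) norm_ge_zero)
  then have "c \<ge> 0" by (simp add: c_def)
  have "d + c *\<^sub>R y \<in> polyhedron_of S t"
    unfolding polyhedron_of_def less_eq_vec_def mem_Collect_eq
  proof
    fix j
    have "(S *v d) $ j \<le> t $ j" "(S *v y) $ j \<le> 0"
      using assms by (auto simp: polyhedron_of_def less_eq_vec_def)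
    then show "(S *v (d + c *\<^sub>R y)) $ j \<le> t $ j"
      using \<open>c \<ge> 0\<close> mult_nonneg_nonpos[of c "(S *v y) $ j"]
      by (simp add: matrix_vector_right_distrib matrix_vector_mult_scaleR)
  qed
  from r[OF this] have "norm (c *\<^sub>R y) - norm d \<le> r"
    by (smt (verit) norm_triangle_ineq norm_minus_cancel add.commute norm_diff_ineq)
  moreover have "norm (c *\<^sub>R y) = r + norm d + 1"
    using \<open>y \<noteq> 0\<close> \<open>r \<ge> 0\<close> by (simp add: c_def)
  ultimately show False by simp
qed

text \<open>Otherwise \<open>0\<close> can be separated from the image of the box \<open>[1, R]\<close>; weighting the negative
  components of \<open>S *v a\<close> by \<open>R\<close> and the others by \<open>1\<close> contradicts the choice of \<open>R\<close>.\<close>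

lemma positive_row_relation:
  fixes S :: "real^'k^'j"
  assumes triv: "\<And>y. S *v y \<le> 0 \<Longrightarrow> y = 0"
  obtains v where "\<And>j. v $ j > 0" "transpose S *v v = 0"
proof -
  \<comment> \<open>\<open>g\<close> and \<open>h\<close> are the total positive and negative parts
    of \<open>S *v x\<close>; weights 1 and \<open>R\<close> on these parts give the inner product
    \<open>g x - R * h x\<close>.\<close>
  define g where "g x = (\<Sum>j\<in>UNIV. max 0 ((S *v x) $ j))" for x
  define h where "h x = (\<Sum>j\<in>UNIV. max 0 (- (S *v x) $ j))" for x
  have S_cont: "continuous_on U (\<lambda>x. (S *v x) $ j)" for U :: "(real^'k) set" and j
    by (intro continuous_intros)
  have g_cont: "continuous_on (sphere 0 1) g" unfolding g_def
    by (intro continuous_intros S_cont)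
  have h_cont: "continuous_on (sphere 0 1) h" unfolding h_def
    by (intro continuous_intros S_cont)
  have compact: "compact (sphere (0 :: real^'k) 1)" and ne: "sphere (0 :: real^'k) 1 \<noteq> {}"
    by auto
  obtain z where z: "z \<in> sphere 0 1" "\<And>x. x \<in> sphere 0 1 \<Longrightarrow> h z \<le> h x"
    using continuous_attains_inf[OF compact ne h_cont] by blast
  obtain w where w: "w \<in> sphere 0 1" "\<And>x. x \<in> sphere 0 1 \<Longrightarrow> g x \<le> g w"
    using continuous_attains_sup[OF compact ne g_cont] by blast
  have "h z \<ge> 0" unfolding h_def by (intro sum_nonneg) auto
  \<comment> \<open>Without negative components, \<open>- z\<close> would be a nonzero solution of
    \<open>S *v y \<le> 0\<close>.\<close>
  moreover have "h z \<noteq> 0"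
  proof
    assume "h z = 0"
    then have "\<forall>j. max 0 (- (S *v z) $ j) = 0"
      unfolding h_def by (subst (asm) sum_nonneg_eq_0_iff) auto
    then have "(S *v (- z)) $ j \<le> 0" for j
      using linear_neg[OF matrix_vector_mul_linear[of S], of z]
      by (metis max.cobounded2 vector_uminus_component)
    then have "- z = 0" by (intro triv) (simp add: less_eq_vec_def)
    then show False using z(1) by simp
  qed
  ultimately have hz: "h z > 0" by simp
  have "g w \<ge> 0" unfolding g_def by (intro sum_nonneg) auto
  \<comment> \<open>Chosen so that \<open>g w - R * h z = - h z\<close>, a negative upper bound for
    \<open>g - R * h\<close> on the whole sphere.\<close>
  define R where "R = 1 + g w / h z"
  have "R \<ge> 1" using hz \<open>g w \<ge> 0\<close> by (simp add: R_def)
  define one where "one = ((\<chi> j. 1) :: real^'j)"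
  have box: "x \<in> cbox one (R *\<^sub>R one) \<longleftrightarrow> (\<forall>j. 1 \<le> x $ j \<and> x $ j \<le> R)" for x :: "real^'j"
    by (simp add: mem_box_cart one_def)
  define T where "T = (\<lambda>v. transpose S *v v) ` cbox one (R *\<^sub>R one)"
  have "convex T" unfolding T_def
    by (intro convex_linear_image matrix_vector_mul_linear convex_box)
  moreover have "compact T" unfolding T_def
    by (intro compact_continuous_image compact_cbox continuous_intros)
  moreover have "0 \<in> T"
  proof (rule ccontr)
    assume "0 \<notin> T"
    then obtain a \<beta> where \<beta>: "a \<bullet> 0 < \<beta>" "\<And>x. x \<in> T \<Longrightarrow> \<beta> < a \<bullet> x"
      using separating_hyperplane_closed_point[of T 0] \<open>convex T\<close> compact_imp_closed[OF \<open>compact T\<close>]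
      by blast
    have pos: "(S *v a) \<bullet> v > 0" if "v \<in> cbox one (R *\<^sub>R one)" for v
    proof -
      have "a \<bullet> (transpose S *v v) > 0"
        using \<beta>(1) \<beta>(2)[of "transpose S *v v"] that by (force simp: T_def)
      then show ?thesis
        by (metis dot_lmul_matrix inner_commute transpose_matrix_vector)
    qed
    have "one \<in> cbox one (R *\<^sub>R one)" using \<open>R \<ge> 1\<close> unfolding box by (simp add: one_def)
    then have "a \<noteq> 0" using pos[of one] by auto
    define e where "e = a /\<^sub>R norm a"
    have e: "e \<in> sphere 0 1" using \<open>a \<noteq> 0\<close> by (simp add: e_def)
    define v where "v = (\<chi> j. if (S *v e) $ j < 0 then R else 1)"
    have "0 < (S *v a) \<bullet> v"
      using \<open>R \<ge> 1\<close> by (intro pos) (simp add: box v_def)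
    then have "0 < (S *v e) \<bullet> v"
      using \<open>a \<noteq> 0\<close> by (simp add: e_def matrix_vector_mult_scaleR)
    also have "(S *v e) \<bullet> v = g e - R * h e"
      unfolding inner_vec_def g_def h_def sum_distrib_left sum_subtractf[symmetric]
      by (rule sum.cong) (auto simp: v_def)
    also have "\<dots> \<le> g w - R * h z"
      using w(2)[OF e] z(2)[OF e] \<open>R \<ge> 1\<close> by (smt (verit) mult_left_mono)
    also have "\<dots> = - h z" using hz by (simp add: R_def field_simps)
    finally show False using hz by simp
  qed
  then obtain v where "v \<in> cbox one (R *\<^sub>R one)" "transpose S *v v = 0"
    unfolding T_def by force
  then show ?thesis
    by (intro that[of v]) (auto simp: box intro: less_le_trans[OF zero_less_one])
qed

text \<open>Taking \<open>V\<close> as a small multiple of \<open>S\<close> makes \<open>A\<close> a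
  multiple of the Gram matrix \<open>transpose S ** S\<close>, definite because \<open>S\<close> has
  trivial kernel. A scaled positive row relation serves as \<open>v\<close>, and \<open>b\<close>
  cancels \<open>transpose V *v t\<close>.\<close>

lemma zrh_pos_def_feasible:
  fixes S :: "real^'k^'j"
  assumes "bounded (polyhedron_of S t)" "d \<in> polyhedron_of S t"
  obtains A b V v where "zrh_feasible S t A b V v" "pos_def A"
proof -
  have triv: "y = 0" if "S *v y \<le> 0" for y
    using recession_trivial[OF assms that] .
  obtain u where u: "\<And>j. u $ j > 0" "transpose S *v u = 0"
    using positive_row_relation[OF triv] by blast
  \<comment> \<open>Scales \<open>u\<close> so that \<open>t \<bullet> v \<le> 1\<close>, whatever
    the sign or size of \<open>t \<bullet> u\<close>.\<close>
  define c where "c = 1 / (1 + \<bar>t \<bullet> u\<bar>)"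
  have "c > 0" by (simp add: c_def add_pos_nonneg)
  define v where "v = c *\<^sub>R u"
  have v: "v $ j > 0" for j using u \<open>c > 0\<close> by (simp add: v_def)
  have "t \<bullet> v \<le> 1"
    by (simp add: v_def c_def field_simps add_pos_nonneg)
  \<comment> \<open>The summand 1 keeps the quotients meaningful for zero rows of
    \<open>S\<close>.\<close>
  define \<epsilon> where "\<epsilon> = Min (range (\<lambda>j. v $ j / (1 + norm (row j S))))"
  have "\<epsilon> > 0"
    unfolding \<epsilon>_def using v by (subst Min_gr_iff) (auto simp: add_pos_nonneg)
  have row_le: "\<epsilon> * norm (row j S) \<le> v $ j" for j
  proof -
    have "\<epsilon> \<le> v $ j / (1 + norm (row j S))" unfolding \<epsilon>_def by (intro Min_le) auto
    then have "\<epsilon> * (1 + norm (row j S)) \<le> v $ j"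
      by (simp add: pos_le_divide_eq add_pos_nonneg)
    then show ?thesis using \<open>\<epsilon> > 0\<close> by (simp add: distrib_left)
  qed
  define V where "V = \<epsilon> *\<^sub>R S"
  define A where "A = transpose V ** S"
  have A: "A = \<epsilon> *\<^sub>R (transpose S ** S)"
    by (simp add: A_def V_def vec_eq_iff matrix_matrix_mult_def transpose_def sum_distrib_left mult.assoc)
  have "sym_mat A"
    by (simp add: sym_mat_def A transpose_scalar matrix_transpose_mul)
  moreover have "0 < x \<bullet> (A *v x)" if "x \<noteq> 0" for x
  proof -
    have "S *v x \<noteq> 0" using triv[of x] that by auto
    have "x \<bullet> (A *v x) = \<epsilon> * (x \<bullet> (transpose S *v (S *v x)))"
      by (simp add: A scaleR_matrix_vector_assoc[symmetric] matrix_vector_mul_assoc)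
    also have "x \<bullet> (transpose S *v (S *v x)) = (S *v x) \<bullet> (S *v x)"
      by (metis dot_lmul_matrix inner_commute transpose_matrix_vector)
    finally show ?thesis using \<open>\<epsilon> > 0\<close> \<open>S *v x \<noteq> 0\<close> by simp
  qed
  ultimately have "pos_def A" by (simp add: pos_def_def)
  moreover have "zrh_feasible S t A (- (transpose V *v t)) V v"
    unfolding zrh_feasible_def
  proof (intro conjI allI)
    show "norm (transpose V *v t + - (transpose V *v t)) + t \<bullet> v \<le> 1"
      using \<open>t \<bullet> v \<le> 1\<close> by simp
    show "transpose S *v v = 0" by (simp only: v_def matrix_vector_mult_scaleR u scaleR_zero_right)
    fix j
    have "row j V = \<epsilon> *\<^sub>R row j S" by (simp add: V_def row_def vec_eq_iff)
    then show "norm (row j V) \<le> v $ j" using row_le[of j] \<open>\<epsilon> > 0\<close> by simp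
  qed (use \<open>sym_mat A\<close> A_def in auto)
  ultimately show ?thesis using that by blast
qed

lemma mat_mult_vec: "mat c *v x = c *\<^sub>R (x :: real^'k)"
proof -
  have "(\<Sum>j\<in>UNIV. (if i = j then c else 0) * x $ j) = c * x $ i" for i
    using sum.delta[of UNIV i "\<lambda>j. c * x $ j"]
    by (simp add: if_distrib if_distribR cong: if_cong)
  then show ?thesis
    by (simp add: vec_eq_iff matrix_vector_mult_def mat_def)
qed

text \<open>A ball of radius \<open>e\<close> inside the polyhedron corresponds to \<open>e\<close>
  times the identity matrix.\<close>

lemma mvie_pos_def_feasible:
  fixes S :: "real^'k^'j"
  assumes "interior (polyhedron_of S t) \<noteq> {}"
  obtains B d where "mvie_feasible S t B d" "pos_def B"
proof -
  obtain d e where e: "e > 0" and ball: "cball d e \<subseteq> polyhedron_of S t"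
    using assms by (metis ex_in_conv mem_interior_cball)
  have "norm (mat e *v row j S) + row j S \<bullet> d \<le> t $ j" for j
  proof -
    \<comment> \<open>The point of the ball farthest in the direction of the row; for a zero row
      \<open>sgn\<close> is zero and the point is the center.\<close>
    let ?x = "d + e *\<^sub>R sgn (row j S)"
    have "?x \<in> cball d e"
      using e by (auto simp: dist_norm norm_sgn)
    then have "row j S \<bullet> ?x \<le> t $ j"
      using ball by (force simp: polyhedron_of_def less_eq_vec_def mat_component_inner)
    moreover have "row j S \<bullet> sgn (row j S) = norm (row j S)"
      by (cases "row j S = 0") (simp_all add: sgn_div_norm dot_square_norm power2_eq_square)
    ultimately show ?thesis using e by (simp add: mat_mult_vec inner_add_right)
  qed
  moreover have "sym_mat (mat e :: real^'k^'k)" by (simp add: sym_mat_def transpose_mat)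
  moreover have "pos_def (mat e :: real^'k^'k)"
    using e by (simp add: pos_def_def sym_mat_def transpose_mat mat_mult_vec)
  ultimately show ?thesis
    using that unfolding mvie_feasible_def by blast
qed

section \<open>Volumes of linear images and of ellipsoids\<close>

text \<open>The library's \<open>measure_linear_image\<close> requires a wellordered index type.\<close>

lemma linear_image_lebesgue:
  fixes f :: "real^'n \<Rightarrow> real^'n"
  assumes "linear f"
  shows "\<forall>X\<in>lmeasurable. f ` X \<in> lmeasurable \<and>
    measure lebesgue (f ` X) = \<bar>det (matrix f)\<bar> * measure lebesgue X"
proof -
  define Q :: "(real^'n \<Rightarrow> real^'n) \<Rightarrow> bool" where "Q f \<longleftrightarrow> (\<forall>X\<in>lmeasurable. f ` X \<in> lmeasurable \<and>
    measure lebesgue (f ` X) = \<bar>det (matrix f)\<bar> * measure lebesgue X)" for f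
  \<comment> \<open>For swaps and shears the determinant has absolute value one, so it suffices to
    check that volumes of boxes are preserved.\<close>
  have volume_preserving: "Q h"
    if h: "linear h" "\<bar>det (matrix h)\<bar> = 1"
      and boxes: "\<And>a b. measure lebesgue (h ` cbox a b) = measure lebesgue (cbox a b)" for h
    unfolding Q_def
  proof (intro ballI)
    fix X :: "(real^'n) set" assume "X \<in> lmeasurable"
    then have "h ` X \<in> lmeasurable \<and> 1 * measure lebesgue X = measure lebesgue (h ` X)"
      by (rule measure_linear_sufficient[OF h(1)]) (simp only: boxes mult_1)
    then show "h ` X \<in> lmeasurable \<and>
        measure lebesgue (h ` X) = \<bar>det (matrix h)\<bar> * measure lebesgue X"
      using h(2) by simp
  qed
  have "Q f"
  \<comment> \<open>Linear maps are generated under composition by maps with a vanishing coordinate,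
    diagonal scalings, swaps and shears; determinants and volume factors both multiply.\<close>
  proof (rule induct_linear_elementary[where P = Q, OF assms])
    fix f g :: "real^'n \<Rightarrow> real^'n"
    assume comp: "linear f" "linear g" "Q f" "Q g"
    show "Q (f \<circ> g)"
      unfolding Q_def
    proof (intro ballI)
      fix X :: "(real^'n) set" assume X: "X \<in> lmeasurable"
      then have "g ` X \<in> lmeasurable" using comp by (simp add: Q_def)
      then show "(f \<circ> g) ` X \<in> lmeasurable \<and>
          measure lebesgue ((f \<circ> g) ` X) = \<bar>det (matrix (f \<circ> g))\<bar> * measure lebesgue X"
        using comp X unfolding Q_def image_comp[symmetric] matrix_compose[OF comp(2,1)] det_mul abs_mult by simp
    qed
  next
    fix f :: "real^'n \<Rightarrow> real^'n" and i
    assume zeroes: "linear f" "\<And>x. f x $ i = 0"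
    \<comment> \<open>The map is singular, so its images are null sets and its determinant is
      zero.\<close>
    have "axis i 1 \<notin> range f"
      using zeroes(2) by (metis axis_nth imageE zero_neq_one)
    then have "\<not> inj f"
      using linear_injective_imp_surjective[OF zeroes(1)] by (metis UNIV_I)
    then have "negligible (f ` X)" for X
      using negligible_linear_singular_image[OF zeroes(1)] by blast
    moreover have "det (matrix f) = 0"
      using det_nz_iff_inj[OF zeroes(1)] \<open>\<not> inj f\<close> by blast
    ultimately show "Q f" by (simp add: Q_def negligible_iff_measure)
  next
    fix c :: "'n \<Rightarrow> real"
    have "matrix (\<lambda>x. \<chi> i. c i * x $ i) = (\<chi> i j. if i = j then c i else 0)"
      by (simp add: matrix_def axis_def vec_eq_iff)
    then have "det (matrix (\<lambda>x. \<chi> i. c i * x $ i)) = prod c UNIV"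
      by (simp add: det_diagonal)
    then show "Q (\<lambda>x. \<chi> i. c i * x $ i)" by (simp add: Q_def measurable_stretch measure_stretch)
  next
    fix m n :: 'n
    let ?p = "Transposition.transpose m n"
    let ?h = "\<lambda>x::real^'n. \<chi> i. x $ ?p i"
    have lin: "linear ?h"
      by (rule linearI) (simp_all add: vec_eq_iff)
    have hh: "?h (?h x) = x" for x
      by (simp add: vec_eq_iff)
    then have "matrix ?h ** matrix ?h = mat 1"
      using matrix_compose[OF lin lin] by (simp add: o_def matrix_id_mat_1[unfolded id_def])
    then have "det (matrix ?h) * det (matrix ?h) = 1"
      by (metis det_mul det_I)
    then have det: "\<bar>det (matrix ?h)\<bar> = 1"
      by (metis abs_mult_self_eq abs_square_eq_1 power2_eq_square)
    have meq: "measure lebesgue (?h ` cbox a b) = measure lebesgue (cbox a b)" for a b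
    proof -
      have ball: "(\<forall>i. Q (?p i)) = (\<forall>i. Q i)" for Q :: "'n \<Rightarrow> bool"
        by (metis transpose_involutory)
      have mem: "?h x \<in> cbox (?h a) (?h b) \<longleftrightarrow> x \<in> cbox a b" for x
        unfolding mem_box_cart vec_lambda_beta
        by (rule ball[of "\<lambda>i. a $ i \<le> x $ i \<and> x $ i \<le> b $ i"])
      have "?h ` cbox a b = cbox (?h a) (?h b)"
      proof (intro equalityI subsetI)
        fix y assume "y \<in> cbox (?h a) (?h b)"
        then have "?h y \<in> cbox a b" using mem[of "?h y"] hh by simp
        then show "y \<in> ?h ` cbox a b" using hh by (intro image_eqI[of _ _ "?h y"]) simp_all
      qed (use mem in auto)
      moreover have "cbox (?h a) (?h b) = {} \<longleftrightarrow> cbox a b = {}"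
        using calculation by (metis image_is_empty)
      moreover have "(\<Prod>i\<in>UNIV. b $ ?p i - a $ ?p i) = (\<Prod>i\<in>UNIV. b $ i - a $ i)"
        using prod.permute[OF permutes_swap_id[of m UNIV n], of "\<lambda>i. b $ i - a $ i"] by (simp add: o_def)
      ultimately show ?thesis by (simp add: content_cbox_if_cart)
    qed
    show "Q ?h"
      by (rule volume_preserving) (fact lin, fact det, fact meq)
  next
    fix m n :: 'n
    assume idplus: "m \<noteq> n"
    let ?h = "\<lambda>x::real^'n. \<chi> i. if i = m then x $ m + x $ n else x $ i"
    have lin: "linear ?h"
      by (rule linearI) (auto simp: vec_eq_iff algebra_simps)
    have "matrix ?h = (\<chi> k. if k = m then row m (mat 1) + 1 *s row n (mat 1) else row k (mat 1))"
      by (auto simp: vec_eq_iff matrix_def axis_def row_def mat_def)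
    then have det: "\<bar>det (matrix ?h)\<bar> = 1"
      using det_row_operation[OF idplus, of "mat 1 :: real^'n^'n" 1] by simp
    have meq: "measure lebesgue (?h ` cbox a b) = measure lebesgue (cbox a b)" for a b
    proof (cases "cbox a b = {}")
      case False
      \<comment> \<open>Translating by \<open>s\<close> moves the lower bound of coordinate
        \<open>n\<close> to 0, as \<open>measure_shear_interval\<close> demands it to be
        nonnegative.\<close>
      define s where "s = axis n (a $ n)"
      have box: "cbox a b = (+) s ` cbox (a - s) (b - s)"
        using cbox_translation[of s "a - s" "b - s"] by simp
      have "?h ` cbox a b = (+) (?h s) ` ?h ` cbox (a - s) (b - s)"
        unfolding box image_image by (simp only: linear_add[OF lin])
      then have "measure lebesgue (?h ` cbox a b) = measure lebesgue (?h ` cbox (a - s) (b - s))"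
        by (simp only: measure_translation)
      also have "\<dots> = measure lebesgue (cbox (a - s) (b - s))"
        using False box by (intro measure_shear_interval[OF idplus]) (auto simp: s_def)
      also have "\<dots> = measure lebesgue (cbox a b)"
        unfolding box by (simp only: measure_translation)
      finally show ?thesis by simp
    qed simp
    show "Q ?h"
      by (rule volume_preserving) (fact lin, fact det, fact meq)
  qed
  then show ?thesis by (simp add: Q_def)
qed

text \<open>Translation preserves measure, and the measure of the unit ball cancels against the
  normalisation in \<open>Vol\<close>.\<close>

lemma Vol_affine_image_cball:
  fixes M :: "real^'k^'k"
  shows "Vol ((\<lambda>u. c + M *v u) ` cball 0 1) = \<bar>det M\<bar>"
proof -
  have "(\<lambda>u. c + M *v u) ` cball 0 1 = (+) c ` ((*v) M ` cball 0 1)"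
    by (simp add: image_image)
  moreover have "measure lebesgue ((*v) M ` cball 0 1) = \<bar>det M\<bar> * measure lebesgue (cball 0 1 :: (real^'k) set)"
    using linear_image_lebesgue[OF matrix_vector_mul_linear[of M]] by simp
  moreover have "measure lebesgue (cball 0 1 :: (real^'k) set) > 0"
    using content_cball_pos[of 1 "0 :: real^'k"] by simp
  ultimately show ?thesis
    by (simp add: Vol_def measure_translation)
qed

text \<open>The ellipsoid is the image of the unit ball under the inverse of the affine map
  \<open>x \<mapsto> A *v x + b\<close>.\<close>

lemma Vol_ellipsoid:
  fixes A :: "real^'k^'k"
  assumes "pos_def A"
  shows "Vol (ellipsoid A b) = 1 / det A"
proof -
  have "det A > 0" by (rule pos_def_det_pos[OF assms])
  then obtain L where L: "L ** A = mat 1" "A ** L = mat 1"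
    using invertible_det_nz[of A] by (auto simp: invertible_def)
  have LA: "L *v (A *v x) = x" and AL: "A *v (L *v x) = x" for x
    by (simp_all add: L matrix_vector_mul_assoc)
  have "ellipsoid A b = (\<lambda>u. - (L *v b) + L *v u) ` cball 0 1"
  proof (intro equalityI subsetI)
    fix x assume "x \<in> ellipsoid A b"
    then have "norm (A *v x + b) \<le> 1"
      by (simp add: ellipsoid_def abs_square_le_1)
    moreover have "x = - (L *v b) + L *v (A *v x + b)"
      by (simp add: matrix_vector_right_distrib LA)
    ultimately show "x \<in> (\<lambda>u. - (L *v b) + L *v u) ` cball 0 1" by (intro image_eqI) auto
  next
    fix x assume "x \<in> (\<lambda>u. - (L *v b) + L *v u) ` cball 0 1"
    then obtain u where u: "norm u \<le> 1" "x = - (L *v b) + L *v u" by auto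
    then have "A *v x + b = u"
      by (simp add: matrix_vector_mult_diff_distrib AL)
    then show "x \<in> ellipsoid A b" using u by (simp add: ellipsoid_def abs_square_le_1)
  qed
  then have "Vol (ellipsoid A b) = \<bar>det L\<bar>" by (simp only: Vol_affine_image_cball)
  moreover have "det L * det A = 1" by (metis L(1) det_mul det_I)
  ultimately show ?thesis using \<open>det A > 0\<close>
    by (smt (verit) nonzero_eq_divide_eq zero_less_mult_pos2)
qed

lemma Vol_smvie:
  fixes B :: "real^'k^'k"
  shows "Vol (smvie B d) = \<bar>det (real CARD('k) *\<^sub>R B)\<bar>"
proof -
  have "smvie B d = (\<lambda>u. d + (real CARD('k) *\<^sub>R B) *v u) ` cball 0 1"
    by (auto simp: smvie_def scaleR_matrix_vector_assoc add.commute)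
  then show ?thesis by (simp add: Vol_affine_image_cball)
qed

section \<open>Comparison of the optimal ellipsoids\<close>

text \<open>The value at \<open>M\<close> is finite, while it is minus infinity off the positive
  definite matrices. One positive definite feasible point therefore makes every optimal matrix
  positive definite.\<close>

lemma log_det_le_pos_def: "pos_def M \<Longrightarrow> log_det M \<le> log_det N \<Longrightarrow> pos_def N"
  by (simp add: log_det_def split: if_splits)

theorem proposition2:
  fixes S :: "real^'k^'j" and t :: "real^'j"
    and A B :: "real^'k^'k" and b d :: "real^'k"
    and V :: "real^'k^'j" and v :: "real^'j"
  assumes "compact (polyhedron_of S t)"
    and "interior (polyhedron_of S t) \<noteq> {}"
    and "zrh_optimal S t A b V v"
    and "mvie_optimal S t B d"
  shows "Vol (ellipsoid A b) \<ge> Vol (smvie B d)"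
proof -
  have "bounded (polyhedron_of S t)" using assms(1) by (rule compact_imp_bounded)
  moreover obtain x where "x \<in> polyhedron_of S t" using assms(2) interior_subset by blast
  ultimately obtain A' b' V' v' where "zrh_feasible S t A' b' V' v'" "pos_def A'"
    using zrh_pos_def_feasible by blast
  then have A: "pos_def A"
    using assms(3) log_det_le_pos_def[of A' A] by (auto simp: zrh_optimal_def)
  obtain B' d' where "mvie_feasible S t B' d'" "pos_def B'"
    using mvie_pos_def_feasible[OF assms(2)] by blast
  then have B: "pos_def B"
    using assms(4) log_det_le_pos_def[of B' B] by (auto simp: mvie_optimal_def)
  have "trace (A ** B) \<le> 1"
    using assms(3,4) zrh_mvie_trace_le by (auto simp: zrh_optimal_def mvie_optimal_def)
  then have "det A * det (real CARD('k) *\<^sub>R B) \<le> 1"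
    by (rule pos_def_det_mult_le[OF A B])
  moreover have "det A > 0" "det (real CARD('k) *\<^sub>R B) > 0"
    using pos_def_det_pos[OF A] pos_def_det_pos[OF B] by (simp_all add: det_scaleR)
  ultimately show ?thesis
    by (simp add: Vol_ellipsoid[OF A] Vol_smvie field_simps)
qed

end
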